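(* Let $0\le\alpha<1$, let $s\ge2$ and $n\ge s+1$ be integers. Among all $\widetilde{\theta}$-digraphs and $\widetilde{\infty}$-digraphs on $n$ vertices containing exactly $s$ directed cycles, the digraph $\widetilde{\infty}(1,1,\ldots,1,n-s)$ (with $s-1$ parameters equal to $1$) is the unique digraph attaining the maximum $A_\alpha$ spectral radius, and the digraph $\widetilde{\theta}(0,1,1,\ldots,1,n-s-1)$ (path parameters $0,1,\ldots,1$ with $s-1$ ones, and $l_1=n-s-1$) is the unique digraph attaining the minimum $A_\alpha$ spectral radius.
   Context: All digraphs are simple. For a digraph $G$, $A(G)$ is its adjacency matrix and $D(G)$ the diagonal matrix of outdegrees; for $\alpha\in[0,1)$, $A_\alpha(G)=\alpha D(G)+(1-\alpha)A(G)$ and $\lambda_\alpha(G)$ is the largest modulus of an eigenvalue of $A_\alpha(G)$. For integers $k_1,\dots,k_s\ge1$, $\widetilde{\infty}(k_1,\ldots,k_s)$ is the digraph formed by $s$ directed cycles of lengths $k_1+1,\dots,k_s+1$ sharing exactly one common vertex ($n=\sum k_i+1$ vertices). For integers $k_1,\dots,k_s\ge0$ (at most one equal to $0$) and $l_1\ge0$, $\widetilde{\theta}(k_1,\ldots,k_s,l_1)$ consists of two vertices $u,v$, $s$ internally disjoint directed paths from $v$ to $u$ with $k_1,\dots,k_s$ internal vertices, and a directed path from $u$ to $v$ with $l_1$ internal vertices, internally disjoint from the others ($n=\sum k_i+l_1+2$ vertices; it contains $s$ directed cycles). *)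

theory Defs
  imports
    "Graph_Theory.Arc_Walk"
    "Graph_Theory.Digraph_Isomorphism"
    "Jordan_Normal_Form.Spectral_Radius"
begin

text \<open>Matrices are indexed by numbers, so the vertices are enumerated by an arbitrary
  list. Another enumeration conjugates the matrices below by a permutation matrix and
  does not change the spectral radius.\<close>

definition vert_list :: "('a, 'b) pre_digraph \<Rightarrow> 'a list" where
  "vert_list G = (SOME vs. distinct vs \<and> set vs = verts G)"

definition adjacency_mat :: "('a, 'b) pre_digraph \<Rightarrow> real mat" where
  "adjacency_mat G = mat (card (verts G)) (card (verts G))
     (\<lambda>(i, j). if vert_list G ! i \<rightarrow>\<^bsub>G\<^esub> vert_list G ! j then 1 else 0)"

definition outdegree_mat :: "('a, 'b) pre_digraph \<Rightarrow> real mat" where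
  "outdegree_mat G = mat (card (verts G)) (card (verts G))
     (\<lambda>(i, j). if i = j then real (out_degree G (vert_list G ! i)) else 0)"

definition A_alpha :: "real \<Rightarrow> ('a, 'b) pre_digraph \<Rightarrow> real mat" where
  "A_alpha \<alpha> G = \<alpha> \<cdot>\<^sub>m outdegree_mat G + (1 - \<alpha>) \<cdot>\<^sub>m adjacency_mat G"

definition A_alpha_radius :: "real \<Rightarrow> ('a, 'b) pre_digraph \<Rightarrow> real" where
  "A_alpha_radius \<alpha> G = spectral_radius (map_mat complex_of_real (A_alpha \<alpha> G))"

text \<open>The predicate \<^const>\<open>pre_digraph.cycle\<close> concerns arc lists with a distinguished
  starting point; passing to the set of arcs identifies the rotations of one cycle.\<close>

definition dicycles :: "('a, 'b) pre_digraph \<Rightarrow> 'b set set" where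
  "dicycles G = set ` {p. pre_digraph.cycle G p}"

text \<open>The arcs of the walk visiting the vertices of a list in order.\<close>

definition path_arcs :: "'a list \<Rightarrow> ('a \<times> 'a) set" where
  "path_arcs xs = set (zip xs (tl xs))"

datatype infty_vertex = Hub | Petal nat nat

definition infty_digraph ::
    "nat list \<Rightarrow> (infty_vertex, infty_vertex \<times> infty_vertex) pre_digraph" where
  "infty_digraph ks = \<lparr>
     verts = insert Hub {Petal i j | i j. i < length ks \<and> j < ks ! i},
     arcs = (\<Union>i < length ks. path_arcs (Hub # map (Petal i) [0..<ks ! i] @ [Hub])),
     tail = fst, head = snd \<rparr>"

datatype theta_vertex = Theta_u | Theta_v | To_u nat nat | To_v nat

definition theta_digraph ::
    "nat list \<Rightarrow> nat \<Rightarrow> (theta_vertex, theta_vertex \<times> theta_vertex) pre_digraph" where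
  "theta_digraph ks l = \<lparr>
     verts = {Theta_u, Theta_v} \<union> {To_u i j | i j. i < length ks \<and> j < ks ! i}
               \<union> {To_v j | j. j < l},
     arcs = (\<Union>i < length ks. path_arcs (Theta_v # map (To_u i) [0..<ks ! i] @ [Theta_u]))
               \<union> path_arcs (Theta_u # map To_v [0..<l] @ [Theta_v]),
     tail = fst, head = snd \<rparr>"

definition is_infty_digraph :: "('a, 'b) pre_digraph \<Rightarrow> bool" where
  "is_infty_digraph G \<longleftrightarrow>
     (\<exists>ks. (\<forall>k \<in> set ks. k \<ge> 1) \<and> digraph_iso G (infty_digraph ks))"

text \<open>At most one of the parallel paths is a single arc, so that the digraph is simple.\<close>

definition is_theta_digraph :: "('a, 'b) pre_digraph \<Rightarrow> bool" where
  "is_theta_digraph G \<longleftrightarrow>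
     (\<exists>ks l. count_list ks 0 \<le> 1 \<and> digraph_iso G (theta_digraph ks l))"

definition theta_infty_family :: "nat \<Rightarrow> nat \<Rightarrow> ('a, 'b) pre_digraph \<Rightarrow> bool" where
  "theta_infty_family n s G \<longleftrightarrow>
     digraph G \<and> (is_theta_digraph G \<or> is_infty_digraph G) \<and>
     card (verts G) = n \<and> card (dicycles G) = s"

end

theory Submission
  imports Defs
begin

text \<open>
  Both kinds of digraphs have a single vertex \<open>h\<close> of outdegree larger than one, and every
  directed cycle passes through it. If \<open>d v\<close> is the distance from \<open>v\<close> to \<open>h\<close>, then
  \<open>v \<mapsto> t ^ d v\<close> is a positive eigenvector for the eigenvalue \<open>\<alpha> + (1 - \<alpha>) / t\<close>, hence this
  eigenvalue is the spectral radius, as soon as the equation at \<open>h\<close> holds; with cycle lengths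
  \<open>c\<^sub>1, \<dots>, c\<^sub>s\<close> it reads
  \<open>t ^ c\<^sub>1 + \<dots> + t ^ c\<^sub>s + \<alpha> (s - 1) / (1 - \<alpha>) * t = 1\<close>. Its left-hand side increases with \<open>t\<close>, so
  a pointwise comparison of \<open>t ^ c\<^sub>1 + \<dots> + t ^ c\<^sub>s\<close> on \<open>0 < t < 1\<close> compares spectral radii. The
  maximum of this sum comes from convexity. For the minimum, \<open>c\<^sub>i\<close> is \<open>n\<close> minus the sum of the
  other parameters \<open>k\<^sub>j\<close>, so no cycle is longer than \<open>n - s + 2\<close>, and one is not longer than
  \<open>n - s + 1\<close>.
\<close>

subsection \<open>Spectral radius from a positive eigenvector\<close>

text \<open>The easy half of Perron-Frobenius: the positive vector \<open>x\<close> makes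
  \<open>r\<close> an eigenvalue, and comparing any other eigenvector with \<open>x\<close>
  entrywise shows that no eigenvalue has larger modulus.\<close>

lemma spectral_radius_eqI_pos_eigenvector:
  fixes A :: "real mat" and x :: "nat \<Rightarrow> real"
  assumes A: "A \<in> carrier_mat n n" and n: "n > 0"
    and nonneg: "\<And>i j. i < n \<Longrightarrow> j < n \<Longrightarrow> A $$ (i, j) \<ge> 0"
    and pos: "\<And>i. i < n \<Longrightarrow> x i > 0"
    and eig: "\<And>i. i < n \<Longrightarrow> (\<Sum>j<n. A $$ (i, j) * x j) = r * x i"
  shows "spectral_radius (map_mat complex_of_real A) = r"
proof -
  let ?A = "map_mat complex_of_real A"
  have A': "?A \<in> carrier_mat n n" using A by simp
  have mult: "(?A *\<^sub>v v) $ i = (\<Sum>j<n. complex_of_real (A $$ (i, j)) * v $ j)"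
    if "v \<in> carrier_vec n" "i < n" for v i
    using A that by (auto simp: scalar_prod_def atLeast0LessThan intro!: sum.cong)
  \<comment> \<open>The spectral radius is a modulus, so \<open>r \<ge> 0\<close> is needed; row 0
    gives it.\<close>
  have "(\<Sum>j<n. A $$ (0, j) * x j) \<ge> 0"
    using nonneg pos n by (intro sum_nonneg mult_nonneg_nonneg) (auto intro: less_imp_le)
  hence lam: "r \<ge> 0" using eig[OF n] pos[OF n] by (simp add: zero_le_mult_iff)
  define v where "v = vec n (\<lambda>i. complex_of_real (x i))"
  have v: "v \<in> carrier_vec n" by (simp add: v_def)
  have "?A *\<^sub>v v = complex_of_real r \<cdot>\<^sub>v v"
  proof (rule eq_vecI)
    fix i assume "i < dim_vec (complex_of_real r \<cdot>\<^sub>v v)"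
    hence i: "i < n" by (simp add: v_def)
    have "(?A *\<^sub>v v) $ i = complex_of_real (\<Sum>j<n. A $$ (i, j) * x j)"
      unfolding mult[OF v i] by (simp add: v_def)
    thus "(?A *\<^sub>v v) $ i = (complex_of_real r \<cdot>\<^sub>v v) $ i"
      using i by (simp add: eig v_def)
  qed (use A in \<open>simp add: v_def\<close>)
  moreover have "v \<noteq> 0\<^sub>v n"
  proof
    assume "v = 0\<^sub>v n"
    hence "v $ 0 = 0" using n by simp
    thus False using n pos[OF n] by (simp add: v_def)
  qed
  ultimately have "eigenvalue ?A (complex_of_real r)"
    using A v unfolding eigenvalue_def eigenvector_def by auto
  hence "cmod (complex_of_real r) \<in> norm ` spectrum ?A" unfolding spectrum_def by blast
  hence ge: "r \<le> spectral_radius ?A"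
    using spectral_radius_mem_max(2)[OF A' n, of "cmod (complex_of_real r)"] lam by simp
  obtain \<mu> where \<mu>: "eigenvalue ?A \<mu>" "spectral_radius ?A = cmod \<mu>"
    using spectral_radius_mem_max(1)[OF A' n] by (auto simp: spectrum_def)
  then obtain z where z: "z \<in> carrier_vec n" "z \<noteq> 0\<^sub>v n" "?A *\<^sub>v z = \<mu> \<cdot>\<^sub>v z"
    using A unfolding eigenvalue_def eigenvector_def by auto
  \<comment> \<open>At an index \<open>m\<close> where \<open>cmod (z $ m) / x m\<close> is maximal,
    the triangle inequality in row \<open>m\<close> of the eigenvector equation gives
    \<open>cmod \<mu> \<le> r\<close>.\<close>
  define q where "q = (\<lambda>i. cmod (z $ i) / x i)"
  obtain m where m: "m < n" "\<And>j. j < n \<Longrightarrow> q j \<le> q m"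
  proof -
    have "finite (q ` {..<n})" "q ` {..<n} \<noteq> {}" using n by auto
    hence "Max (q ` {..<n}) \<in> q ` {..<n}" by (rule Max_in)
    then obtain m where "m < n" "Max (q ` {..<n}) = q m" by auto
    moreover have "q j \<le> Max (q ` {..<n})" if "j < n" for j using that by simp
    ultimately show ?thesis using that[of m] by simp
  qed
  obtain j0 where j0: "j0 < n" "z $ j0 \<noteq> 0"
  proof -
    have "\<exists>j<n. z $ j \<noteq> 0"
    proof (rule ccontr)
      assume "\<not> ?thesis"
      hence "z = 0\<^sub>v n" using z(1) by (intro eq_vecI) auto
      thus False using z(2) by simp
    qed
    thus ?thesis using that by blast
  qed
  have "0 < q j0" using j0 pos by (simp add: q_def)
  hence qm: "q m > 0" using m(2)[OF j0(1)] by simp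
  have zb: "cmod (z $ j) \<le> q m * x j" if "j < n" for j
    using m(2)[OF that] pos[OF that] by (simp add: q_def pos_divide_le_eq)
  have "cmod \<mu> * cmod (z $ m) = cmod ((?A *\<^sub>v z) $ m)"
    using z m(1) by (simp add: norm_mult)
  also have "\<dots> \<le> (\<Sum>j<n. A $$ (m, j) * cmod (z $ j))"
    unfolding mult[OF z(1) m(1)]
    by (rule sum_norm_le) (use nonneg m(1) in \<open>simp add: norm_mult\<close>)
  also have "\<dots> \<le> (\<Sum>j<n. A $$ (m, j) * (q m * x j))"
    using nonneg m(1) zb by (intro sum_mono mult_left_mono) auto
  also have "\<dots> = q m * (\<Sum>j<n. A $$ (m, j) * x j)"
    by (simp add: sum_distrib_left mult_ac)
  also have "\<dots> = r * cmod (z $ m)"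
    using eig[OF m(1)] pos[OF m(1)] by (simp add: q_def)
  finally have "cmod \<mu> * cmod (z $ m) \<le> r * cmod (z $ m)" .
  moreover have "cmod (z $ m) > 0" using qm pos[OF m(1)] by (simp add: q_def zero_less_divide_iff)
  ultimately have "cmod \<mu> \<le> r" by simp
  thus ?thesis using ge \<mu>(2) by simp
qed

text \<open>This restates the criterion with out-arcs in place of matrix rows; the arbitrary
  enumeration of the vertices disappears by reindexing along a bijection.\<close>

lemma A_alpha_radius_eqI_pos_eigenvector:
  fixes \<alpha> r :: real
  assumes "digraph G" and ne: "verts G \<noteq> {}" and \<alpha>: "0 \<le> \<alpha>" "\<alpha> \<le> 1"
    and pos: "\<And>v. v \<in> verts G \<Longrightarrow> f v > 0"
    and eig: "\<And>v. v \<in> verts G \<Longrightarrow>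
      \<alpha> * out_degree G v * f v + (1 - \<alpha>) * (\<Sum>e \<in> out_arcs G v. f (head G e)) = r * f v"
  shows "A_alpha_radius \<alpha> G = r"
proof -
  interpret digraph G by fact
  define vs where "vs = vert_list G"
  define n where "n = card (verts G)"
  have "\<exists>vs. distinct vs \<and> set vs = verts G"
    using finite_distinct_list[OF finite_verts] by blast
  hence vs: "distinct vs" "set vs = verts G"
    using someI_ex[of "\<lambda>vs. distinct vs \<and> set vs = verts G"] unfolding vs_def vert_list_def
    by blast+
  have len: "length vs = n" using distinct_card[OF vs(1)] vs(2) by (simp add: n_def)
  have n: "n > 0" using ne by (simp add: n_def card_gt_0_iff)
  have bij: "bij_betw ((!) vs) {..<n} (verts G)"
    using bij_betw_nth[OF vs(1)] len vs(2) by auto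
  have mem: "vs ! i \<in> verts G" if "i < n" for i using nth_mem[of i vs] that len vs(2) by simp
  have entry: "A_alpha \<alpha> G $$ (i, j) =
      (if i = j then \<alpha> * out_degree G (vs ! i) else 0) +
      (if vs ! i \<rightarrow>\<^bsub>G\<^esub> vs ! j then 1 - \<alpha> else 0)" if "i < n" "j < n" for i j
    using that by (simp add: A_alpha_def outdegree_mat_def adjacency_mat_def n_def vs_def)
  \<comment> \<open>Without parallel arcs, \<open>head G\<close> is injective on the arcs leaving
    \<open>v\<close>, so summing over out-neighbours is summing over out-arcs.\<close>
  have heads: "(\<Sum>w \<in> verts G. if v \<rightarrow>\<^bsub>G\<^esub> w then (1 - \<alpha>) * f w else 0) =
      (1 - \<alpha>) * (\<Sum>e \<in> out_arcs G v. f (head G e))" for v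
  proof -
    have "(\<Sum>w \<in> verts G. if v \<rightarrow>\<^bsub>G\<^esub> w then (1 - \<alpha>) * f w else 0) =
        (\<Sum>w \<in> {w \<in> verts G. v \<rightarrow>\<^bsub>G\<^esub> w}. (1 - \<alpha>) * f w)"
      by (rule sum.inter_filter[symmetric]) simp
    also have "{w \<in> verts G. v \<rightarrow>\<^bsub>G\<^esub> w} = head G ` out_arcs G v"
      by (auto simp: arcs_ends_conv)
    also have "(\<Sum>w \<in> head G ` out_arcs G v. (1 - \<alpha>) * f w) =
        (\<Sum>e \<in> out_arcs G v. (1 - \<alpha>) * f (head G e))"
      by (rule sum.reindex_cong[OF _ refl refl])
         (auto intro!: inj_onI no_multi_arcs simp: arc_to_ends_def)
    finally show ?thesis by (simp add: sum_distrib_left)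
  qed
  show ?thesis unfolding A_alpha_radius_def
  proof (rule spectral_radius_eqI_pos_eigenvector[where n = n and x = "\<lambda>i. f (vs ! i)"])
    show "A_alpha \<alpha> G \<in> carrier_mat n n"
      by (simp add: A_alpha_def adjacency_mat_def outdegree_mat_def n_def)
    show "n > 0" by fact
    show "A_alpha \<alpha> G $$ (i, j) \<ge> 0" if "i < n" "j < n" for i j
      using that \<alpha> by (simp add: entry)
    show "f (vs ! i) > 0" if "i < n" for i using pos mem that by blast
    fix i assume i: "i < n"
    have "(\<Sum>j<n. A_alpha \<alpha> G $$ (i, j) * f (vs ! j)) =
        (\<Sum>j<n. (if i = j then \<alpha> * out_degree G (vs ! i) * f (vs ! i) else 0) +
          (if vs ! i \<rightarrow>\<^bsub>G\<^esub> vs ! j then (1 - \<alpha>) * f (vs ! j) else 0))"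
      using i by (intro sum.cong refl) (auto simp: entry algebra_simps)
    also have "\<dots> = \<alpha> * out_degree G (vs ! i) * f (vs ! i) +
        (\<Sum>j<n. if vs ! i \<rightarrow>\<^bsub>G\<^esub> vs ! j then (1 - \<alpha>) * f (vs ! j) else 0)"
      using i by (simp add: sum.distrib)
    also have "(\<Sum>j<n. if vs ! i \<rightarrow>\<^bsub>G\<^esub> vs ! j then (1 - \<alpha>) * f (vs ! j) else 0) =
        (\<Sum>w \<in> verts G. if vs ! i \<rightarrow>\<^bsub>G\<^esub> w then (1 - \<alpha>) * f w else 0)"
      by (rule sum.reindex_bij_betw[OF bij])
    finally show "(\<Sum>j<n. A_alpha \<alpha> G $$ (i, j) * f (vs ! j)) = r * f (vs ! i)"
      using eig[OF mem[OF i]] by (simp add: heads)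
  qed
qed

subsection \<open>Digraphs with a hub\<close>

context wf_digraph begin

text \<open>The vertex sequence of a closed walk is its tails followed by the end, and also the
  start followed by its heads. Start and end agree, so tails and heads form the same multiset; the
  heads are distinct by the definition of \<open>cycle\<close>.\<close>

lemma cycle_arcs_tails_heads:
  assumes "cycle p"
  shows "distinct (map (tail G) p)" and "tail G ` set p = head G ` set p"
proof -
  from assms obtain u where u: "awalk u p u" "distinct (tl (awalk_verts u p))" "p \<noteq> []"
    unfolding cycle_def by blast
  have cas: "cas u p u" using u by auto
  have eq: "map (tail G) p @ [head G (last p)] = tail G (hd p) # map (head G) p"
    using awalk_verts_conv[of u p] awalk_verts_conv'[OF cas] u(3) by simp
  have "tail G (hd p) = u" using cas u(3) by (simp add: cas_simp)
  moreover have "head G (last p) = u"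
    using u(1,3) awlast_of_awalk[OF u(1)] awalk_verts_conv[of u p] by simp
  ultimately have "mset (map (tail G) p) = mset (map (head G) p)"
    using arg_cong[OF eq, of mset] by simp
  moreover have "distinct (map (head G) p)"
    using u(2,3) awalk_verts_conv'[OF cas] by simp
  ultimately show "distinct (map (tail G) p)" "tail G ` set p = head G ` set p"
    using mset_eq_imp_distinct_iff mset_eq_setD by (blast, fastforce)
qed

text \<open>The way back from head to tail can be taken without repeated vertices, so that
  \<open>e\<close> closes it to a cycle.\<close>

lemma cycle_through_arc:
  assumes "e \<in> arcs G" and "head G e \<rightarrow>\<^sup>* tail G e"
  obtains p where "cycle p" and "e \<in> set p"
proof -
  obtain q where q: "apath (head G e) q (tail G e)" using assms(2) reachable_apath by blast
  have "cycle (e # q)" unfolding cycle_def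
    using q assms(1) by (auto simp: apath_def awalk_Cons_iff intro!: exI[of _ "tail G e"])
  thus ?thesis using that by auto
qed

end

text \<open>The value of \<^term>\<open>d\<close> at a vertex is the length of the unique path from it to the
  hub \<^term>\<open>h\<close>, and \<^term>\<open>M\<close> collects the lengths of the directed cycles, all of which pass
  through the hub.\<close>

definition hub_cycle_lengths :: "('a, 'b) pre_digraph \<Rightarrow> nat multiset \<Rightarrow> bool" where
  "hub_cycle_lengths G M \<longleftrightarrow> (\<exists>h d. h \<in> verts G \<and> d h = 0 \<and>
     (\<forall>v \<in> verts G - {h}. \<exists>e. out_arcs G v = {e} \<and> d v = Suc (d (head G e))) \<and>
     M = image_mset (\<lambda>e. Suc (d (head G e))) (mset_set (out_arcs G h)))"

text \<open>The distance function is pulled back along the isomorphism. Cycle lengths then have to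
  be computed only for the two standard models.\<close>

lemma hub_cycle_lengths_iso:
  assumes "wf_digraph G" and "digraph_iso G H" and "hub_cycle_lengths H M"
  shows "hub_cycle_lengths G M"
proof -
  interpret wf_digraph G by fact
  from assms(2) obtain \<phi> where \<phi>: "digraph_isomorphism \<phi>" and H: "H = app_iso \<phi> G"
    unfolding digraph_iso_def by blast
  from assms(3) obtain h d where h: "h \<in> verts H" "d h = 0"
    and d: "\<And>v. v \<in> verts H - {h} \<Longrightarrow>
      \<exists>e. out_arcs H v = {e} \<and> d v = Suc (d (head H e))"
    and M: "M = image_mset (\<lambda>e. Suc (d (head H e))) (mset_set (out_arcs H h))"
    unfolding hub_cycle_lengths_def by blast
  obtain g where g: "g \<in> verts G" "iso_verts \<phi> g = h" using h(1) H by auto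
  have inj: "inj_on (iso_arcs \<phi>) (out_arcs G v)" for v
    using digraph_isomorphism_inj_on_arcs[OF \<phi>] by (rule inj_on_subset) auto
  have out: "out_arcs H (iso_verts \<phi> v) = iso_arcs \<phi> ` out_arcs G v" if "v \<in> verts G" for v
    using out_arcs_app_iso_eq[OF \<phi> that] H by simp
  have hd: "head H (iso_arcs \<phi> e) = iso_verts \<phi> (head G e)" if "e \<in> out_arcs G v" for e v
    using iso_verts_head[OF \<phi>, of e] H that by simp
  have "\<exists>e. out_arcs G v = {e} \<and> d (iso_verts \<phi> v) = Suc (d (iso_verts \<phi> (head G e)))"
    if v: "v \<in> verts G - {g}" for v
  proof -
    have "iso_verts \<phi> v \<in> verts H - {h}"
      using v g \<phi> H by auto
    then obtain e where e: "out_arcs H (iso_verts \<phi> v) = {e}"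
      "d (iso_verts \<phi> v) = Suc (d (head H e))" using d by blast
    obtain e' where e': "e' \<in> out_arcs G v" "e = iso_arcs \<phi> e'" using e(1) out[of v] v by blast
    have "out_arcs G v = {e'}"
      using e(1) e' out[of v] v inj[of v] unfolding inj_on_def by blast
    thus ?thesis using e(2) e'(2) hd[OF e'(1)] by auto
  qed
  moreover have "M = image_mset (\<lambda>e. Suc (d (iso_verts \<phi> (head G e)))) (mset_set (out_arcs G g))"
    unfolding M out[OF g(1), unfolded g(2)] image_mset_mset_set[OF inj, symmetric]
      multiset.map_comp
    by (rule image_mset_cong) (use hd in \<open>cases "finite (out_arcs G g)"; auto\<close>)
  ultimately show ?thesis unfolding hub_cycle_lengths_def
    using g h(2) by (intro exI[of _ g] exI[of _ "d \<circ> iso_verts \<phi>"]) auto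
qed

text \<open>A cycle is determined by its arc leaving the hub, since afterwards every vertex has a
  single out-arc until the hub is met again. Every arc leaving the hub lies on a cycle, since all
  vertices reach the hub.\<close>

lemma card_dicycles_hub:
  assumes "fin_digraph G" and "hub_cycle_lengths G M"
  shows "card (dicycles G) = size M"
proof -
  interpret fin_digraph G by fact
  from assms(2) obtain h d where h: "h \<in> verts G" "d h = 0"
    and d: "\<And>v. v \<in> verts G - {h} \<Longrightarrow>
      \<exists>e. out_arcs G v = {e} \<and> d v = Suc (d (head G e))"
    and M: "M = image_mset (\<lambda>e. Suc (d (head G e))) (mset_set (out_arcs G h))"
    unfolding hub_cycle_lengths_def by blast
  have uniq: "e = e'" if "e \<in> arcs G" "e' \<in> arcs G" "tail G e = tail G e'" "tail G e \<noteq> h" for e e'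
    using d[of "tail G e"] that by (metis DiffI in_out_arcs_conv singletonD tail_in_verts)
  have dstep: "d (tail G e) = Suc (d (head G e))" if "e \<in> arcs G" "tail G e \<noteq> h" for e
    using d[of "tail G e"] that by (metis DiffI in_out_arcs_conv singletonD tail_in_verts)
  have reach: "v \<rightarrow>\<^sup>*\<^bsub>G\<^esub> h" if "v \<in> verts G" for v
    using that
  proof (induction "d v" arbitrary: v rule: less_induct)
    case less
    show ?case
    proof (cases "v = h")
      case False
      then obtain e where e: "out_arcs G v = {e}" "d v = Suc (d (head G e))"
        using d[of v] less.prems by blast
      have e': "e \<in> arcs G" "tail G e = v" using e(1) in_out_arcs_conv[of e G v] by auto
      have "head G e \<rightarrow>\<^sup>*\<^bsub>G\<^esub> h" using less.hyps[of "head G e"] e(2) e' by simp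
      thus ?thesis using e' by (metis adj_reachable_trans in_arcs_imp_in_arcs_ends)
    qed (use h in auto)
  qed
  \<comment> \<open>On a cycle avoiding the hub, the arc whose tail has least \<open>d\<close> would
    be followed by one whose tail has smaller \<open>d\<close>.\<close>
  have hub: "\<exists>e \<in> set p. tail G e = h" if p: "cycle p" for p
  proof (rule ccontr)
    assume neg: "\<not> ?thesis"
    have sub: "set p \<subseteq> arcs G" "p \<noteq> []" using p unfolding cycle_def by auto
    obtain e where e: "e \<in> set p" "\<And>e'. e' \<in> set p \<Longrightarrow> d (tail G e) \<le> d (tail G e')"
      using ex_has_least_nat[of "\<lambda>e. e \<in> set p" "hd p" "\<lambda>e. d (tail G e)"] sub(2)
      by auto
    obtain e' where e': "e' \<in> set p" "tail G e' = head G e"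
      using cycle_arcs_tails_heads(2)[OF p] e(1) by (metis imageE imageI)
    show False using e(2)[OF e'(1)] e' dstep[of e] neg sub e(1) by force
  qed
  \<comment> \<open>Induction along \<open>p\<close> from the hub arc \<open>e0\<close>, which is
    the only arc of \<open>p\<close> leaving the hub. The predecessor \<open>e1\<close> of any other
    arc \<open>e\<close> is \<open>e0\<close> or has a tail with \<open>d\<close> one larger than
    that of \<open>e\<close>, so it lies on \<open>p'\<close> already; its successor there leaves
    the same vertex as \<open>e\<close> and hence equals \<open>e\<close>.\<close>
  have sub: "set p \<subseteq> set p'"
    if p: "cycle p" "cycle p'" and e0: "e0 \<in> set p" "e0 \<in> set p'" "tail G e0 = h" for p p' e0
  proof
    fix e assume "e \<in> set p"
    define N where "N = Max (d ` verts G)"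
    have N: "d v \<le> N" if "v \<in> verts G" for v using that by (simp add: N_def)
    have A: "set p \<subseteq> arcs G" "set p' \<subseteq> arcs G" using p unfolding cycle_def by auto
    have inj: "inj_on (tail G) (set p)"
      using cycle_arcs_tails_heads(1)[OF p(1)] by (simp add: distinct_map)
    show "e \<in> set p'" using \<open>e \<in> set p\<close>
    proof (induction "N - d (tail G e)" arbitrary: e rule: less_induct)
      case less
      show ?case
      proof (cases "tail G e = h")
        case True
        thus ?thesis using inj e0 less.prems by (metis inj_onD)
      next
        case False
        obtain e1 where e1: "e1 \<in> set p" "head G e1 = tail G e"
          using cycle_arcs_tails_heads(2)[OF p(1)] less.prems by (metis imageE imageI)
        have "e1 \<in> set p'"
        proof (cases "tail G e1 = h")
          case True
          thus ?thesis using inj e0 e1 by (metis inj_onD)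
        next
          case False
          have "d (tail G e1) = Suc (d (tail G e))" using dstep[of e1] False e1 A by auto
          moreover have "d (tail G e1) \<le> N" using N e1 A by auto
          ultimately show ?thesis using less.hyps[OF _ e1(1)] by simp
        qed
        then obtain e2 where e2: "e2 \<in> set p'" "tail G e2 = tail G e"
          using cycle_arcs_tails_heads(2)[OF p(2)] e1(2) by (metis imageE imageI)
        hence "e2 = e" using uniq[of e2 e] A less.prems False by auto
        thus ?thesis using e2 by simp
      qed
    qed
  qed
  define hub_arc where "hub_arc = (\<lambda>C. SOME e. e \<in> C \<and> tail G e = h)"
  have hub_arc: "hub_arc C \<in> C" "tail G (hub_arc C) = h" if C: "C \<in> dicycles G" for C
  proof -
    have "\<exists>e. e \<in> C \<and> tail G e = h" using that hub unfolding dicycles_def by auto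
    from someI_ex[OF this] show "hub_arc C \<in> C" "tail G (hub_arc C) = h"
      by (simp_all add: hub_arc_def)
  qed
  have arcs: "C \<subseteq> arcs G" if "C \<in> dicycles G" for C
    using that unfolding dicycles_def cycle_def by auto
  have eq: "C = C'"
    if "C \<in> dicycles G" "C' \<in> dicycles G" "e \<in> C" "e \<in> C'" "tail G e = h" for C C' e
    using that sub unfolding dicycles_def by blast
  have "bij_betw hub_arc (dicycles G) (out_arcs G h)"
  proof (rule bij_betw_imageI)
    show "inj_on hub_arc (dicycles G)"
      by (rule inj_onI) (metis eq hub_arc)
    show "hub_arc ` dicycles G = out_arcs G h"
    proof
      show "hub_arc ` dicycles G \<subseteq> out_arcs G h" using hub_arc arcs by fastforce
      show "out_arcs G h \<subseteq> hub_arc ` dicycles G"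
      proof
        fix e assume e: "e \<in> out_arcs G h"
        then obtain p where p: "cycle p" "e \<in> set p"
          using cycle_through_arc[of e] reach[of "head G e"] by auto
        hence C: "set p \<in> dicycles G" by (auto simp: dicycles_def)
        have "hub_arc (set p) = e"
          using hub_arc[OF C] p(2) e cycle_arcs_tails_heads(1)[OF p(1)]
          by (auto simp: distinct_map dest: inj_onD)
        thus "e \<in> hub_arc ` dicycles G" using C by blast
      qed
    qed
  qed
  hence "card (dicycles G) = card (out_arcs G h)" by (rule bij_betw_same_card)
  thus ?thesis by (simp add: M)
qed

text \<open>Away from the hub the eigenvector equation for \<open>t ^ d v\<close> is automatic, as
  the only out-arc lowers \<open>d\<close> by one. The hypothesis \<open>root\<close> supplies the
  equation at the hub.\<close>

lemma A_alpha_radius_hub: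
  assumes "digraph G" and M: "hub_cycle_lengths G M" and \<alpha>: "0 \<le> \<alpha>" "\<alpha> < 1" and t: "t > 0"
    and root: "(\<Sum>c \<in># M. t ^ c) + \<alpha> * (real (size M) - 1) / (1 - \<alpha>) * t = 1"
  shows "A_alpha_radius \<alpha> G = \<alpha> + (1 - \<alpha>) / t"
proof -
  interpret digraph G by fact
  from M obtain h d where h: "h \<in> verts G" "d h = 0"
    and d: "\<And>v. v \<in> verts G - {h} \<Longrightarrow>
      \<exists>e. out_arcs G v = {e} \<and> d v = Suc (d (head G e))"
    and M: "M = image_mset (\<lambda>e. Suc (d (head G e))) (mset_set (out_arcs G h))"
    unfolding hub_cycle_lengths_def by blast
  have size: "size M = out_degree G h" by (simp add: M out_degree_def)
  define S where "S = (\<Sum>e \<in> out_arcs G h. t ^ d (head G e))"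
  have "(\<Sum>c \<in># M. t ^ c) = t * S"
    by (simp add: M S_def multiset.map_comp comp_def sum_unfold_sum_mset[symmetric] sum_distrib_left)
  hence "t * S + \<alpha> * (real (out_degree G h) - 1) / (1 - \<alpha>) * t = 1" using root size by simp
  \<comment> \<open>This is the root equation times \<open>(1 - \<alpha>) / t\<close>; the
    eigenvector has value \<open>t ^ 0 = 1\<close> at the hub.\<close>
  hence hubeq: "\<alpha> * out_degree G h + (1 - \<alpha>) * S = \<alpha> + (1 - \<alpha>) / t"
    using t \<alpha> by (simp add: field_simps)
  show ?thesis
  proof (rule A_alpha_radius_eqI_pos_eigenvector[where f = "\<lambda>v. t ^ d v"])
    show "digraph G" "verts G \<noteq> {}" "0 \<le> \<alpha>" "\<alpha> \<le> 1" using assms h by auto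
    show "t ^ d v > 0" for v using t by simp
    fix v assume v: "v \<in> verts G"
    show "\<alpha> * out_degree G v * t ^ d v + (1 - \<alpha>) * (\<Sum>e \<in> out_arcs G v. t ^ d (head G e)) =
        (\<alpha> + (1 - \<alpha>) / t) * t ^ d v"
    proof (cases "v = h")
      case True
      thus ?thesis using hubeq h(2) by (simp add: S_def)
    next
      case False
      then obtain e where e: "out_arcs G v = {e}" "d v = Suc (d (head G e))" using d v by blast
      hence "out_degree G v = 1" by (simp add: out_degree_def)
      thus ?thesis using e t by (simp add: field_simps)
    qed
  qed
qed

subsection \<open>The digraphs of the two families\<close>

text \<open>The arcs are indexed by their tails: one leaves \<open>a\<close> and one leaves each
  inner vertex. The out-arcs of the two models are read off from this form.\<close>

lemma path_arcs_map:
  "path_arcs (a # map f [0..<k] @ [b]) = insert (a, if k = 0 then b else f 0)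
    ((\<lambda>j. (f j, if Suc j < k then f (Suc j) else b)) ` {..<k})"
proof -
  have "path_arcs (a # map f [0..<k] @ [b]) =
      (\<lambda>j. ((a # map f [0..<k] @ [b]) ! j, (map f [0..<k] @ [b]) ! j)) ` {..k}"
    unfolding path_arcs_def set_zip by (auto simp: less_Suc_eq_le)
  also have "\<dots> = (\<lambda>j. (if j = 0 then a else f (j - 1), if j < k then f j else b)) ` {..k}"
    by (rule image_cong) (auto simp: nth_Cons nth_append split: nat.split)
  also have "{..k} = insert 0 (Suc ` {..<k})"
    by (simp flip: lessThan_Suc_atMost add: lessThan_Suc_eq_insert_0)
  finally show ?thesis by (simp add: image_image)
qed

lemma map_prod_path_arcs: "map_prod g g ` path_arcs xs = path_arcs (map g xs)"
proof -
  have "path_arcs (map g xs) = set (map (map_prod g g) (zip xs (tl xs)))"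
    unfolding path_arcs_def map_tl[symmetric] zip_map_map map_prod_def by (simp add: case_prod_beta)
  thus ?thesis by (simp add: path_arcs_def)
qed

lemma digraph_pairI:
  assumes "finite V" and "finite A" and "\<And>x y. (x, y) \<in> A \<Longrightarrow> x \<in> V \<and> y \<in> V \<and> x \<noteq> y"
  shows "digraph \<lparr>verts = V, arcs = A, tail = fst, head = snd\<rparr>"
  by unfold_locales (use assms in \<open>auto simp: arc_to_ends_def\<close>)

lemma digraph_iso_pairI:
  assumes "digraph \<lparr>verts = V, arcs = A, tail = fst, head = snd\<rparr>" (is "digraph ?G")
    and "inj_on g V" and "g ` V = V'" and "map_prod g g ` A = A'"
  shows "digraph_iso \<lparr>verts = V, arcs = A, tail = fst, head = snd\<rparr>
    \<lparr>verts = V', arcs = A', tail = fst, head = snd\<rparr>"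
proof -
  interpret digraph ?G by fact
  let ?\<phi> = "\<lparr>iso_verts = g, iso_arcs = map_prod g g, iso_head = snd, iso_tail = fst\<rparr>"
  have "A \<subseteq> V \<times> V" using tail_in_verts head_in_verts by fastforce
  hence "inj_on (map_prod g g) A"
    using map_prod_inj_on[OF assms(2,2)] inj_on_subset by blast
  hence "pre_digraph.digraph_isomorphism ?G ?\<phi>"
    using assms(2) wf_digraph by (auto simp: pre_digraph.digraph_isomorphism_def)
  thus ?thesis unfolding digraph_iso_def
    using assms(3,4) by (intro exI[of _ ?\<phi>]) (auto simp: app_iso_def)
qed

lemma card_verts_iso:
  assumes "digraph_iso G H"
  shows "card (verts G) = card (verts H)"
  using assms by (auto simp: digraph_iso_def pre_digraph.digraph_isomorphism_def card_image)

lemma image_mset_nth_lessThan: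
  "image_mset (\<lambda>i. f (xs ! i)) (mset_set {..<length xs}) = mset (map f xs)"
proof -
  have "mset (map f xs) = mset (map f (map ((!) xs) [0..<length xs]))" by (simp only: map_nth)
  thus ?thesis by (simp add: multiset.map_comp comp_def atLeast0LessThan)
qed

lemma UN_lessThan_permutes:
  assumes "p permutes {..<n :: nat}"
  shows "(\<Union>i<n. F (p i)) = (\<Union>i<n. F i)"
proof -
  have "(\<Union>i<n. F (p i)) = (\<Union>i \<in> p ` {..<n}. F i)" by simp
  thus ?thesis by (simp only: permutes_image[OF assms])
qed

section \<open>Cycles sharing one vertex\<close>

lemma infty_verts_eq:
  "{Petal i j |i j. i < length ks \<and> j < ks ! i} = (\<Union>i<length ks. Petal i ` {..<ks ! i})"
  by auto

lemma card_verts_infty_digraph: "card (verts (infty_digraph ks)) = Suc (sum_list ks)"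
proof -
  have "card (\<Union>i<length ks. Petal i ` {..<ks ! i}) = (\<Sum>i<length ks. card (Petal i ` {..<ks ! i}))"
    by (rule card_UN_disjoint) auto
  also have "\<dots> = sum_list ks"
    by (simp add: card_image inj_on_def sum_list_sum_nth atLeast0LessThan)
  finally have "card (\<Union>i<length ks. Petal i ` {..<ks ! i}) = sum_list ks" .
  moreover have "finite (\<Union>i<length ks. Petal i ` {..<ks ! i})"
    "Hub \<notin> (\<Union>i<length ks. Petal i ` {..<ks ! i})" by auto
  ultimately have "card (insert Hub (\<Union>i<length ks. Petal i ` {..<ks ! i})) = Suc (sum_list ks)"
    by simp
  thus ?thesis unfolding infty_digraph_def infty_verts_eq by (simp only: pre_digraph.simps)
qed

text \<open>A petal without inner vertices would be the loop \<open>(Hub, Hub)\<close>, which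
  \<open>k \<ge> 1\<close> excludes.\<close>

lemma digraph_infty_digraph:
  assumes "\<And>k. k \<in> set ks \<Longrightarrow> k \<ge> 1"
  shows "digraph (infty_digraph ks)"
  unfolding infty_digraph_def
proof (rule digraph_pairI)
  show "finite (insert Hub {Petal i j |i j. i < length ks \<and> j < ks ! i})"
    unfolding infty_verts_eq by simp
  fix x y assume "(x, y) \<in> (\<Union>i<length ks. path_arcs (Hub # map (Petal i) [0..<ks ! i] @ [Hub]))"
  then obtain i where i: "i < length ks" "(x, y) \<in> path_arcs (Hub # map (Petal i) [0..<ks ! i] @ [Hub])"
    by blast
  have "ks ! i \<ge> 1" using i assms by simp
  hence "(x = Hub \<and> y = Petal i 0) \<or>
      (\<exists>j<ks ! i. x = Petal i j \<and> y = (if Suc j < ks ! i then Petal i (Suc j) else Hub))"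
    using i(2) unfolding path_arcs_map by auto
  thus "x \<in> insert Hub {Petal i j |i j. i < length ks \<and> j < ks ! i} \<and>
      y \<in> insert Hub {Petal i j |i j. i < length ks \<and> j < ks ! i} \<and> x \<noteq> y"
    using i(1) \<open>ks ! i \<ge> 1\<close> by (auto simp: Suc_le_eq split: if_splits)
qed (simp add: path_arcs_map)

lemma hub_cycle_lengths_infty_digraph:
  assumes "\<And>k. k \<in> set ks \<Longrightarrow> k \<ge> 1"
  shows "hub_cycle_lengths (infty_digraph ks) (mset (map Suc ks))"
proof -
  let ?G = "infty_digraph ks"
  \<comment> \<open>From \<open>Petal i j\<close> there remain \<open>ks ! i - j\<close> arcs to the
    hub. The first petal vertex is at distance \<open>ks ! i\<close>, which gives a cycle of length
    \<open>Suc (ks ! i)\<close>.\<close>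
  define d where "d = (\<lambda>v. case v of Hub \<Rightarrow> 0 | Petal i j \<Rightarrow> ks ! i - j)"
  have pos: "ks ! i > 0" if "i < length ks" for i using assms that by (auto simp: less_eq_Suc_le)
  have hub: "out_arcs ?G Hub = (\<lambda>i. (Hub, Petal i 0)) ` {..<length ks}"
    using pos by (auto simp: infty_digraph_def out_arcs_def path_arcs_map split: if_splits)
  have petal: "out_arcs ?G (Petal i j) =
      {(Petal i j, if Suc j < ks ! i then Petal i (Suc j) else Hub)}"
    if "i < length ks" "j < ks ! i" for i j
    using that by (auto simp: infty_digraph_def out_arcs_def path_arcs_map intro!: bexI[of _ i])
  have "mset (map Suc ks) = image_mset (\<lambda>i. Suc (ks ! i)) (mset_set {..<length ks})"
    by (rule image_mset_nth_lessThan[symmetric])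
  also have "\<dots> = image_mset (\<lambda>e. Suc (d (head ?G e)))
      (image_mset (\<lambda>i. (Hub, Petal i 0)) (mset_set {..<length ks}))"
    by (simp add: multiset.map_comp comp_def infty_digraph_def d_def)
  also have "\<dots> = image_mset (\<lambda>e. Suc (d (head ?G e))) (mset_set (out_arcs ?G Hub))"
    unfolding hub by (subst image_mset_mset_set) (auto simp: inj_on_def)
  finally have M: "mset (map Suc ks) = \<dots>" .
  have "\<exists>e. out_arcs ?G v = {e} \<and> d v = Suc (d (head ?G e))" if v: "v \<in> verts ?G - {Hub}" for v
  proof -
    obtain i j where ij: "v = Petal i j" "i < length ks" "j < ks ! i"
      using v by (auto simp: infty_digraph_def)
    show ?thesis unfolding ij(1) petal[OF ij(2,3)]
      using ij(3) by (auto simp: d_def infty_digraph_def)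
  qed
  thus ?thesis unfolding hub_cycle_lengths_def using M
    by (intro exI[of _ Hub] exI[of _ d]) (auto simp: d_def infty_digraph_def)
qed

text \<open>Relabelling the petals by a permutation is an isomorphism, so uniqueness only has to be
  shown for the multiset of parameters.\<close>

lemma infty_digraph_mset_cong:
  assumes "mset ks = mset ks'" and "\<And>k. k \<in> set ks \<Longrightarrow> k \<ge> 1"
  shows "digraph_iso (infty_digraph ks) (infty_digraph ks')"
proof -
  obtain p where p: "p permutes {..<length ks'}" "permute_list p ks' = ks"
    using assms(1) by (rule mset_eq_permutation)
  have len: "length ks = length ks'" using assms(1) by (rule mset_eq_length)
  have nth: "ks ! i = ks' ! p i" if "i < length ks'" for i
    using permute_list_nth[OF p(1) that] p(2) by simp
  define g where "g = (\<lambda>v. case v of Hub \<Rightarrow> Hub | Petal i j \<Rightarrow> Petal (p i) j)"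
  have g: "g Hub = Hub" "g (Petal i j) = Petal (p i) j" for i j by (simp_all add: g_def)
  have inj: "inj g"
    using permutes_inj[OF p(1)] by (auto simp: inj_def g_def split: infty_vertex.splits)
  have "g ` {Petal i j |i j. i < length ks \<and> j < ks ! i} =
      (\<Union>i<length ks'. Petal (p i) ` {..<ks' ! p i})"
    unfolding infty_verts_eq image_UN unfolding len by (intro SUP_cong refl) (simp add: image_image g nth)
  also have "\<dots> = {Petal i j |i j. i < length ks' \<and> j < ks' ! i}"
    unfolding infty_verts_eq by (rule UN_lessThan_permutes[OF p(1)])
  finally have V: "g ` insert Hub {Petal i j |i j. i < length ks \<and> j < ks ! i} =
      insert Hub {Petal i j |i j. i < length ks' \<and> j < ks' ! i}" by (simp add: g)
  have "map_prod g g ` (\<Union>i<length ks. path_arcs (Hub # map (Petal i) [0..<ks ! i] @ [Hub])) =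
      (\<Union>i<length ks'. path_arcs (Hub # map (Petal (p i)) [0..<ks' ! p i] @ [Hub]))"
    unfolding image_UN map_prod_path_arcs unfolding len map_prod_path_arcs
    by (intro SUP_cong refl) (simp add: g nth comp_def)
  also have "\<dots> = (\<Union>i<length ks'. path_arcs (Hub # map (Petal i) [0..<ks' ! i] @ [Hub]))"
    by (rule UN_lessThan_permutes[OF p(1)])
  finally show ?thesis unfolding infty_digraph_def
    by (intro digraph_iso_pairI[OF digraph_infty_digraph[OF assms(2), unfolded infty_digraph_def]
          inj_on_subset[OF inj subset_UNIV] V])
qed

section \<open>Theta digraphs\<close>

lemma theta_verts_eq:
  "{Theta_u, Theta_v} \<union> {To_u i j |i j. i < length ks \<and> j < ks ! i} \<union> {To_v j |j. j < l} =
    {Theta_u, Theta_v} \<union> (\<Union>i<length ks. To_u i ` {..<ks ! i}) \<union> To_v ` {..<l}"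
  by auto

lemma card_verts_theta_digraph: "card (verts (theta_digraph ks l)) = sum_list ks + l + 2"
proof -
  let ?U = "\<Union>i<length ks. To_u i ` {..<ks ! i}"
  have "card ?U = (\<Sum>i<length ks. card (To_u i ` {..<ks ! i}))"
    by (rule card_UN_disjoint) auto
  also have "\<dots> = sum_list ks"
    by (simp add: card_image inj_on_def sum_list_sum_nth atLeast0LessThan)
  finally have U: "card ?U = sum_list ks" .
  have "card ({Theta_u, Theta_v} \<union> ?U) = 2 + sum_list ks"
    by (subst card_Un_disjoint) (auto simp: U)
  moreover have "card (To_v ` {..<l}) = l" by (simp add: card_image inj_on_def)
  ultimately have "card ({Theta_u, Theta_v} \<union> ?U \<union> To_v ` {..<l}) = 2 + sum_list ks + l"
    by (subst card_Un_disjoint) auto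
  thus ?thesis unfolding theta_digraph_def theta_verts_eq
    by (simp only: pre_digraph.simps)
qed

lemma digraph_theta_digraph: "digraph (theta_digraph ks l)"
  unfolding theta_digraph_def
proof (rule digraph_pairI)
  let ?V = "{Theta_u, Theta_v} \<union> {To_u i j |i j. i < length ks \<and> j < ks ! i} \<union> {To_v j |j. j < l}"
  show "finite ?V" unfolding theta_verts_eq by simp
  fix x y assume "(x, y) \<in> (\<Union>i<length ks. path_arcs (Theta_v # map (To_u i) [0..<ks ! i] @ [Theta_u]))
      \<union> path_arcs (Theta_u # map To_v [0..<l] @ [Theta_v])"
  then consider (to_u) i where "i < length ks"
      "(x, y) \<in> path_arcs (Theta_v # map (To_u i) [0..<ks ! i] @ [Theta_u])"
    | (to_v) "(x, y) \<in> path_arcs (Theta_u # map To_v [0..<l] @ [Theta_v])" by blast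
  thus "x \<in> ?V \<and> y \<in> ?V \<and> x \<noteq> y"
  proof cases
    case to_u
    hence "(x = Theta_v \<and> y = (if ks ! i = 0 then Theta_u else To_u i 0)) \<or>
        (\<exists>j<ks ! i. x = To_u i j \<and> y = (if Suc j < ks ! i then To_u i (Suc j) else Theta_u))"
      unfolding path_arcs_map by auto
    thus ?thesis using to_u(1) by (auto split: if_splits)
  next
    case to_v
    hence "(x = Theta_u \<and> y = (if l = 0 then Theta_v else To_v 0)) \<or>
        (\<exists>j<l. x = To_v j \<and> y = (if Suc j < l then To_v (Suc j) else Theta_v))"
      unfolding path_arcs_map by auto
    thus ?thesis by (auto split: if_splits)
  qed
qed (simp add: path_arcs_map)

lemma count_list_le_1_nth_eq:
  assumes "count_list xs x \<le> 1" and "i < length xs" "j < length xs" "xs ! i = x" "xs ! j = x"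
  shows "i = j"
proof -
  have "card {i. i < length xs \<and> xs ! i = x} \<le> Suc 0"
    using assms(1) by (simp add: count_list_eq_length_filter length_filter_conv_card eq_commute)
  moreover have "finite {i. i < length xs \<and> xs ! i = x}" by simp
  ultimately show ?thesis using assms(2-5) by (auto simp: card_le_Suc0_iff_eq)
qed

text \<open>The hub is \<open>Theta_v\<close>, where the parallel paths start. A cycle uses
  \<open>k + 1\<close> arcs to reach \<open>Theta_u\<close> and \<open>l + 1\<close> arcs to
  return.\<close>

lemma hub_cycle_lengths_theta_digraph:
  assumes "count_list ks 0 \<le> 1"
  shows "hub_cycle_lengths (theta_digraph ks l) (mset (map (\<lambda>k. k + l + 2) ks))"
proof -
  let ?G = "theta_digraph ks l"
  define d where "d = (\<lambda>v. case v of Theta_v \<Rightarrow> 0 | Theta_u \<Rightarrow> Suc l |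
    To_v j \<Rightarrow> l - j | To_u i j \<Rightarrow> ks ! i - j + Suc l)"
  define first where "first = (\<lambda>i. if ks ! i = 0 then Theta_u else To_u i 0)"
  have hub: "out_arcs ?G Theta_v = (\<lambda>i. (Theta_v, first i)) ` {..<length ks}"
    by (auto simp: theta_digraph_def out_arcs_def path_arcs_map first_def split: if_splits)
  have u: "out_arcs ?G Theta_u = {(Theta_u, if l = 0 then Theta_v else To_v 0)}"
    by (auto simp: theta_digraph_def out_arcs_def path_arcs_map split: if_splits)
  have to_u: "out_arcs ?G (To_u i j) =
      {(To_u i j, if Suc j < ks ! i then To_u i (Suc j) else Theta_u)}"
    if "i < length ks" "j < ks ! i" for i j
    using that by (auto simp: theta_digraph_def out_arcs_def path_arcs_map intro!: bexI[of _ i])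
  have to_v: "out_arcs ?G (To_v j) = {(To_v j, if Suc j < l then To_v (Suc j) else Theta_v)}"
    if "j < l" for j
    using that by (auto simp: theta_digraph_def out_arcs_def path_arcs_map)
  \<comment> \<open>Two parameters \<open>0\<close> would share the arc from \<open>Theta_v\<close>
    to \<open>Theta_u\<close>. With at most one of them the first arcs are distinct, and the
    multiset has one entry for each path.\<close>
  have inj: "inj_on (\<lambda>i. (Theta_v, first i)) {..<length ks}"
    using count_list_le_1_nth_eq[OF assms] by (auto simp: inj_on_def first_def split: if_splits)
  have "mset (map (\<lambda>k. k + l + 2) ks) = image_mset (\<lambda>i. ks ! i + l + 2) (mset_set {..<length ks})"
    by (rule image_mset_nth_lessThan[symmetric])
  also have "\<dots> = image_mset (\<lambda>e. Suc (d (head ?G e)))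
      (image_mset (\<lambda>i. (Theta_v, first i)) (mset_set {..<length ks}))"
    unfolding multiset.map_comp
    by (rule image_mset_cong) (simp add: theta_digraph_def d_def first_def)
  also have "\<dots> = image_mset (\<lambda>e. Suc (d (head ?G e))) (mset_set (out_arcs ?G Theta_v))"
    unfolding hub by (subst image_mset_mset_set[OF inj]) simp
  finally have M: "mset (map (\<lambda>k. k + l + 2) ks) = \<dots>" .
  have "\<exists>e. out_arcs ?G v = {e} \<and> d v = Suc (d (head ?G e))" if v: "v \<in> verts ?G - {Theta_v}" for v
  proof (cases v)
    case Theta_u
    show ?thesis unfolding Theta_u u by (auto simp: d_def theta_digraph_def)
  next
    case Theta_v
    thus ?thesis using v by simp
  next
    case (To_u i j)
    hence ij: "i < length ks" "j < ks ! i" using v by (auto simp: theta_digraph_def)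
    show ?thesis unfolding To_u to_u[OF ij] using ij(2) by (auto simp: d_def theta_digraph_def)
  next
    case (To_v j)
    hence j: "j < l" using v by (auto simp: theta_digraph_def)
    show ?thesis unfolding To_v to_v[OF j] using j by (auto simp: d_def theta_digraph_def)
  qed
  thus ?thesis unfolding hub_cycle_lengths_def using M
    by (intro exI[of _ Theta_v] exI[of _ d]) (auto simp: d_def theta_digraph_def)
qed

text \<open>The parallel paths are permuted while the return path stays fixed.\<close>

lemma theta_digraph_mset_cong:
  assumes "mset ks = mset ks'"
  shows "digraph_iso (theta_digraph ks l) (theta_digraph ks' l)"
proof -
  obtain p where p: "p permutes {..<length ks'}" "permute_list p ks' = ks"
    using assms(1) by (rule mset_eq_permutation)
  have len: "length ks = length ks'" using assms(1) by (rule mset_eq_length)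
  have nth: "ks ! i = ks' ! p i" if "i < length ks'" for i
    using permute_list_nth[OF p(1) that] p(2) by simp
  define g where "g = (\<lambda>v. case v of To_u i j \<Rightarrow> To_u (p i) j | _ \<Rightarrow> v)"
  have g: "g Theta_u = Theta_u" "g Theta_v = Theta_v" "g (To_u i j) = To_u (p i) j"
    "g (To_v j) = To_v j" for i j by (simp_all add: g_def)
  have inj: "inj g"
    using permutes_inj[OF p(1)] by (auto simp: inj_def g_def split: theta_vertex.splits)
  have "g ` (\<Union>i<length ks. To_u i ` {..<ks ! i}) =
      (\<Union>i<length ks'. To_u (p i) ` {..<ks' ! p i})"
    unfolding image_UN unfolding len by (intro SUP_cong refl) (simp add: image_image g nth)
  also have "\<dots> = (\<Union>i<length ks'. To_u i ` {..<ks' ! i})"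
    by (rule UN_lessThan_permutes[OF p(1)])
  finally have V: "g ` ({Theta_u, Theta_v} \<union> (\<Union>i<length ks. To_u i ` {..<ks ! i}) \<union> To_v ` {..<l}) =
      {Theta_u, Theta_v} \<union> (\<Union>i<length ks'. To_u i ` {..<ks' ! i}) \<union> To_v ` {..<l}"
    by (simp only: image_Un) (simp add: g image_image)
  have "map_prod g g ` (\<Union>i<length ks. path_arcs (Theta_v # map (To_u i) [0..<ks ! i] @ [Theta_u])) =
      (\<Union>i<length ks'. path_arcs (Theta_v # map (To_u (p i)) [0..<ks' ! p i] @ [Theta_u]))"
    unfolding image_UN map_prod_path_arcs unfolding len
    by (intro SUP_cong refl) (simp add: g nth comp_def)
  also have "\<dots> = (\<Union>i<length ks'. path_arcs (Theta_v # map (To_u i) [0..<ks' ! i] @ [Theta_u]))"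
    by (rule UN_lessThan_permutes[OF p(1)])
  finally have A1: "map_prod g g `
      (\<Union>i<length ks. path_arcs (Theta_v # map (To_u i) [0..<ks ! i] @ [Theta_u])) = \<dots>" .
  have A2: "map_prod g g ` path_arcs (Theta_u # map To_v [0..<l] @ [Theta_v]) =
      path_arcs (Theta_u # map To_v [0..<l] @ [Theta_v])"
    by (simp add: map_prod_path_arcs g comp_def)
  show ?thesis unfolding theta_digraph_def theta_verts_eq
    by (intro digraph_iso_pairI[OF digraph_theta_digraph[of ks l, unfolded theta_digraph_def theta_verts_eq]
          inj_on_subset[OF inj subset_UNIV] V]) (simp only: image_Un A1 A2)
qed

subsection \<open>Comparison of spectral radii\<close>

lemma sum_mset_power_mono:
  fixes t u :: real
  assumes "0 \<le> t" "t \<le> u"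
  shows "(\<Sum>c \<in># M. t ^ c) \<le> (\<Sum>c \<in># M. u ^ c)"
  by (induction M) (auto intro!: add_mono power_mono assms)

text \<open>Intermediate value theorem: the left-hand side is 0 at 0, as all exponents are positive,
  and at least 2 at 1.\<close>

lemma sum_mset_power_root:
  fixes b :: real
  assumes "size M \<ge> 2" and "\<And>c. c \<in># M \<Longrightarrow> c > 0" and b: "b \<ge> 0"
  obtains t where "0 < t" "t < 1" "(\<Sum>c \<in># M. t ^ c) + b * t = 1"
proof -
  let ?f = "\<lambda>t::real. (\<Sum>c \<in># M. t ^ c) + b * t"
  have cont: "continuous_on A (\<lambda>t::real. \<Sum>c \<in># M. t ^ c)" for A
    by (induction M) (auto intro!: continuous_intros)
  have "(\<Sum>c \<in># M. (0::real) ^ c) = 0"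
    using assms(2) by (induction M) auto
  hence f0: "?f 0 = 0" by simp
  have f1: "?f 1 = size M + b" by simp
  have "\<exists>t. 0 \<le> t \<and> t \<le> 1 \<and> ?f t = 1"
    using f0 f1 assms(1) b by (intro IVT') (auto intro!: continuous_intros cont)
  then obtain t where t: "0 \<le> t" "t \<le> 1" "?f t = 1" by blast
  moreover have "t \<noteq> 0" "t \<noteq> 1" using t(3) f0 f1 assms(1) b by fastforce+
  ultimately show ?thesis using that[of t] by simp
qed

lemma hub_cycle_lengths_pos:
  assumes "hub_cycle_lengths G M" and "c \<in># M"
  shows "c > 0"
  using assms by (auto simp: hub_cycle_lengths_def)

text \<open>Equal numbers of cycles give both root equations the same linear term. The smaller power
  sum then has the larger root, and \<open>\<alpha> + (1 - \<alpha>) / t\<close> decreases in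
  \<open>t\<close>.\<close>

lemma A_alpha_radius_hub_less:
  assumes G: "digraph G" "hub_cycle_lengths G M" and H: "digraph H" "hub_cycle_lengths H N"
    and \<alpha>: "0 \<le> \<alpha>" "\<alpha> < 1" and size: "size M = size N" "size N \<ge> 2"
    and less: "\<And>t::real. 0 < t \<Longrightarrow> t < 1 \<Longrightarrow> (\<Sum>c \<in># M. t ^ c) < (\<Sum>c \<in># N. t ^ c)"
  shows "A_alpha_radius \<alpha> G < A_alpha_radius \<alpha> H"
proof -
  define b where "b = \<alpha> * (real (size N) - 1) / (1 - \<alpha>)"
  have b: "b \<ge> 0" using \<alpha> size(2) by (simp add: b_def)
  obtain t where t: "0 < t" "t < 1" "(\<Sum>c \<in># M. t ^ c) + b * t = 1"
    using sum_mset_power_root[of M b] hub_cycle_lengths_pos[OF G(2)] size b by auto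
  obtain u where u: "0 < u" "u < 1" "(\<Sum>c \<in># N. u ^ c) + b * u = 1"
    using sum_mset_power_root[of N b] hub_cycle_lengths_pos[OF H(2)] size b by auto
  \<comment> \<open>If \<open>t \<le> u\<close>, monotonicity bounds the left-hand side for
    \<open>N\<close> at \<open>t\<close> by its value 1 at \<open>u\<close>, but there it exceeds
    the one for \<open>M\<close>, which is 1.\<close>
  have "u < t"
  proof (rule ccontr)
    assume "\<not> u < t"
    hence "t \<le> u" by simp
    hence "(\<Sum>c \<in># N. t ^ c) + b * t \<le> (\<Sum>c \<in># N. u ^ c) + b * u"
      using t(1) b by (intro add_mono sum_mset_power_mono mult_left_mono) auto
    thus False using less[OF t(1,2)] t(3) u(3) by simp
  qed
  hence "\<alpha> + (1 - \<alpha>) / t < \<alpha> + (1 - \<alpha>) / u"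
    using \<alpha> t u by (intro add_strict_left_mono divide_strict_left_mono) auto
  thus ?thesis
    using A_alpha_radius_hub[OF G \<alpha> t(1)] A_alpha_radius_hub[OF H \<alpha> u(1)] t(3) u(3) size
    by (simp add: b_def)
qed

text \<open>Both radii come from one root \<open>t\<close>. This gives equality for isomorphic
  digraphs without comparing vertex enumerations.\<close>

lemma A_alpha_radius_hub_eq:
  assumes "digraph G" "hub_cycle_lengths G M" and "digraph H" "hub_cycle_lengths H M"
    and \<alpha>: "0 \<le> \<alpha>" "\<alpha> < 1" and "size M \<ge> 2"
  shows "A_alpha_radius \<alpha> G = A_alpha_radius \<alpha> H"
proof -
  have "\<alpha> * (real (size M) - 1) / (1 - \<alpha>) \<ge> 0" using assms by simp
  then obtain t where t: "0 < t" "(\<Sum>c \<in># M. t ^ c) + \<alpha> * (real (size M) - 1) / (1 - \<alpha>) * t = 1"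
    using sum_mset_power_root[of M] hub_cycle_lengths_pos[OF assms(2)] assms(7) by metis
  show ?thesis
    using A_alpha_radius_hub[OF assms(1,2) \<alpha> t] A_alpha_radius_hub[OF assms(3,4) \<alpha> t] by simp
qed

text \<open>Convexity of the powers of \<open>t\<close>, in the form \<open>t ^ a + t ^ b \<le> 1 + t ^ (a + b)\<close>: a sum
  over exponents of given total is largest when all but one of them vanish.\<close>

lemma sum_power_less_or_extremal:
  fixes t :: real
  assumes t: "0 < t" "t < 1" and "ds \<noteq> []"
  shows "(\<Sum>d\<leftarrow>ds. t ^ d) < real (length ds - 1) + t ^ sum_list ds \<or>
    mset ds = replicate_mset (length ds - 1) 0 + {#sum_list ds#}"
  using assms(3)
proof (induction ds rule: list_nonempty_induct)
  case (cons d ds)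
  define S where "S = sum_list ds"
  have len: "real (length (d # ds) - 1) = real (length ds - 1) + 1"
    using cons.hyps by (cases ds) auto
  have len': "replicate_mset (length (d # ds) - 1) (0::nat) = add_mset 0 (replicate_mset (length ds - 1) 0)"
    using cons.hyps by (cases ds) auto
  \<comment> \<open>Both factors are nonnegative, and the product vanishes exactly when
    \<open>d = 0\<close> or \<open>S = 0\<close>. This separates the strict inequality from the
    extremal multisets.\<close>
  have conv: "1 + t ^ (d + S) - t ^ d - t ^ S = (1 - t ^ d) * (1 - t ^ S)"
    by (simp add: algebra_simps power_add)
  have le1: "t ^ m \<le> 1" for m using t by (simp add: power_le_one)
  from cons.IH consider
      (less) "(\<Sum>d\<leftarrow>ds. t ^ d) < real (length ds - 1) + t ^ S"
    | (ext) "mset ds = replicate_mset (length ds - 1) 0 + {#S#}"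
    unfolding S_def by blast
  thus ?case
  proof cases
    case less
    have "(1 - t ^ d) * (1 - t ^ S) \<ge> 0" using le1 by (intro mult_nonneg_nonneg) auto
    hence "t ^ d + (\<Sum>d\<leftarrow>ds. t ^ d) < real (length (d # ds) - 1) + t ^ (d + S)"
      using less conv len by linarith
    thus ?thesis by (simp add: S_def)
  next
    case ext
    have "(\<Sum>d\<leftarrow>ds. t ^ d) = (\<Sum>d \<in># mset ds. t ^ d)" by (simp flip: sum_mset_sum_list)
    also have "\<dots> = real (length ds - 1) + t ^ S" unfolding ext by simp
    finally have eq: "(\<Sum>d\<leftarrow>ds. t ^ d) = real (length ds - 1) + t ^ S" .
    show ?thesis
    proof (cases "d = 0 \<or> S = 0")
      case True
      hence "mset (d # ds) = replicate_mset (length (d # ds) - 1) 0 + {#d + S#}"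
        unfolding len' using ext by (auto simp: add_mset_commute)
      thus ?thesis unfolding S_def by simp
    next
      case False
      hence "t ^ d < 1" "t ^ S < 1" using t by (simp_all add: power_Suc_less_one power_less_one_iff)
      hence "(1 - t ^ d) * (1 - t ^ S) > 0" by simp
      hence "t ^ d + (\<Sum>d\<leftarrow>ds. t ^ d) < real (length (d # ds) - 1) + t ^ (d + S)"
        using eq conv len by linarith
      thus ?thesis by (simp add: S_def)
    qed
  qed
qed simp

lemma sum_power_le_extremal:
  fixes t :: real
  assumes "0 < t" "t < 1" and "ds \<noteq> []"
  shows "(\<Sum>d\<leftarrow>ds. t ^ d) \<le> real (length ds - 1) + t ^ sum_list ds"
proof -
  have "(\<Sum>d\<leftarrow>ds. t ^ d) = (\<Sum>d \<in># mset ds. t ^ d)" by (simp flip: sum_mset_sum_list)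
  thus ?thesis using sum_power_less_or_extremal[OF assms] by auto
qed

section \<open>Power sums of cycle lengths: the upper extreme\<close>

text \<open>With \<open>t^2\<close> factored out of each term, the exponents \<open>k - 1\<close>
  have the fixed total \<open>n - s - 1\<close>, and the convexity bound applies with its equality
  case.\<close>

lemma sum_power_infty_less_max:
  fixes t :: real
  assumes t: "0 < t" "t < 1" and ks: "\<And>k. k \<in> set ks \<Longrightarrow> k \<ge> 1" "length ks = s" "s \<ge> 1"
    and sum: "Suc (sum_list ks) = n"
    and ne: "mset ks \<noteq> mset (replicate (s - 1) 1 @ [n - s])"
  shows "(\<Sum>c \<in># mset (map Suc ks). t ^ c) <
    (\<Sum>c \<in># mset (map Suc (replicate (s - 1) 1 @ [n - s])). t ^ c)"
proof -
  define ds where "ds = map (\<lambda>k. k - 1) ks"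
  have ks_ds: "ks = map Suc ds"
    unfolding ds_def map_map comp_def using ks(1) by (intro map_idI[symmetric]) fastforce
  have len: "length ds = s" using ks(2) by (simp add: ds_def)
  have "sum_list (map Suc ds) = sum_list ds + length ds" by (induction ds) auto
  hence n: "n = Suc (sum_list ds + s)" using sum ks_ds len by simp
  have "mset ds \<noteq> replicate_mset (length ds - 1) 0 + {#sum_list ds#}"
  proof
    assume "mset ds = replicate_mset (length ds - 1) 0 + {#sum_list ds#}"
    hence "mset ks = image_mset Suc (replicate_mset (s - 1) 0 + {#sum_list ds#})"
      using ks_ds len by simp
    thus False using ne n by simp
  qed
  moreover have "ds \<noteq> []" using len ks(3) by auto
  ultimately have "(\<Sum>d\<leftarrow>ds. t ^ d) < real (s - 1) + t ^ sum_list ds"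
    using sum_power_less_or_extremal[OF t, of ds] len by auto
  hence "t\<^sup>2 * (\<Sum>d\<leftarrow>ds. t ^ d) < t\<^sup>2 * (real (s - 1) + t ^ sum_list ds)"
    using t by (intro mult_strict_left_mono) auto
  moreover have "(\<Sum>c \<in># mset (map Suc ks). t ^ c) = t\<^sup>2 * (\<Sum>d\<leftarrow>ds. t ^ d)"
    unfolding ks_ds by (induction ds) (auto simp: algebra_simps power2_eq_square)
  moreover have "(\<Sum>c \<in># mset (map Suc (replicate (s - 1) 1 @ [n - s])). t ^ c) =
      t\<^sup>2 * (real (s - 1) + t ^ sum_list ds)"
    using n by (simp add: algebra_simps power2_eq_square)
  ultimately show ?thesis by simp
qed

text \<open>The return path is counted in every cycle, so the reduced exponents \<open>k + l\<close>
  have total at least \<open>n - 2\<close>, which exceeds \<open>n - s - 1\<close>. Strictness comes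
  from this total, and the weak convexity bound suffices.\<close>

lemma sum_power_theta_less_max:
  fixes t :: real
  assumes t: "0 < t" "t < 1" and ks: "length ks = s" "s \<ge> 2"
    and sum: "sum_list ks + l + 2 = n" and n: "n \<ge> s + 1"
  shows "(\<Sum>c \<in># mset (map (\<lambda>k. k + l + 2) ks). t ^ c) <
    (\<Sum>c \<in># mset (map Suc (replicate (s - 1) 1 @ [n - s])). t ^ c)"
proof -
  define ds where "ds = map (\<lambda>k. k + l) ks"
  have len: "length ds = s" "ds \<noteq> []" using ks by (auto simp: ds_def)
  have "sum_list ds = sum_list ks + length ks * l" unfolding ds_def by (induction ks) auto
  moreover have "length ks * l \<ge> l" using ks by simp
  ultimately have "sum_list ds > n - s - 1" using sum ks(2) n by linarith
  hence "t ^ sum_list ds < t ^ (n - s - 1)" using t by (simp add: power_strict_decreasing)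
  hence "(\<Sum>d\<leftarrow>ds. t ^ d) < real (s - 1) + t ^ (n - s - 1)"
    using sum_power_le_extremal[OF t len(2)] len(1) by simp
  hence "t\<^sup>2 * (\<Sum>d\<leftarrow>ds. t ^ d) < t\<^sup>2 * (real (s - 1) + t ^ (n - s - 1))"
    using t by (intro mult_strict_left_mono) auto
  moreover have "(\<Sum>c \<in># mset (map (\<lambda>k. k + l + 2) ks). t ^ c) = t\<^sup>2 * (\<Sum>d\<leftarrow>ds. t ^ d)"
    unfolding ds_def by (induction ks) (auto simp: algebra_simps power2_eq_square)
  moreover have "(\<Sum>c \<in># mset (map Suc (replicate (s - 1) 1 @ [n - s])). t ^ c) =
      t\<^sup>2 * (real (s - 1) + t ^ (n - s - 1))"
  proof -
    obtain m where "n = s + 1 + m" using n le_Suc_ex by blast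
    thus ?thesis by (simp add: algebra_simps power2_eq_square)
  qed
  ultimately show ?thesis by simp
qed

section \<open>Power sums of cycle lengths: the lower extreme\<close>

lemma sum_list_ge_length_mult:
  fixes b :: real
  assumes "\<And>x. x \<in> set xs \<Longrightarrow> b \<le> f x"
  shows "real (length xs) * b \<le> (\<Sum>x\<leftarrow>xs. f x)"
  using assms by (induction xs) (auto simp: algebra_simps intro: add_mono)

text \<open>The \<open>length ks - 1\<close> entries besides \<open>k\<close> contribute at least 1
  each. With the number of vertices fixed, this bounds the length of each cycle.\<close>

lemma length_add_le_sum_list:
  fixes ks :: "nat list"
  assumes "\<And>k. k \<in> set ks \<Longrightarrow> k \<ge> 1" and "k \<in> set ks"
  shows "length ks + k \<le> Suc (sum_list ks)"
proof -
  have le: "length xs \<le> sum_list xs" if "\<And>k. k \<in> set xs \<Longrightarrow> k \<ge> 1" for xs :: "nat list"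
    using that by (induction xs) (auto, fastforce)
  obtain xs ys where "ks = xs @ k # ys" using assms(2) by (meson split_list)
  thus ?thesis using le[of xs] le[of ys] assms(1) by auto
qed

text \<open>The parameter \<open>0\<close> gives the one shorter cycle, of length
  \<open>n - s + 1\<close>; each parameter \<open>1\<close> gives a cycle of length
  \<open>n - s + 2\<close>.\<close>

lemma sum_power_theta_min:
  fixes t :: real
  assumes "s \<ge> 2" "n \<ge> s + 1"
  shows "(\<Sum>c \<in># mset (map (\<lambda>k. k + (n - s - 1) + 2) (0 # replicate (s - 1) 1)). t ^ c) =
    t ^ (n - s + 1) + real (s - 1) * t ^ (n - s + 2)"
proof -
  obtain m where "n = s + 1 + m" using assms(2) le_Suc_ex by blast
  thus ?thesis by simp
qed

text \<open>Each term is at least \<open>t ^ (n - s + 1)\<close>, which beats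
  \<open>t ^ (n - s + 2)\<close> in the remaining \<open>s - 1 > 0\<close> places. This settles all
  digraphs of the family except theta digraphs with a parameter \<open>0\<close>.\<close>

lemma sum_power_short_cycles_greater_min:
  fixes t :: real
  assumes t: "0 < t" "t < 1" and cs: "length cs = s" "s \<ge> 2" "\<And>c. c \<in> set cs \<Longrightarrow> c \<le> n - s + 1"
  shows "t ^ (n - s + 1) + real (s - 1) * t ^ (n - s + 2) < (\<Sum>c\<leftarrow>cs. t ^ c)"
proof -
  obtain m where m: "s = Suc m" "m > 0" using cs(2) by (cases s) auto
  have "t ^ (n - s + 2) < t ^ (n - s + 1)" using t by (intro power_strict_decreasing) auto
  hence "real m * t ^ (n - s + 2) < real m * t ^ (n - s + 1)"
    using m(2) by (intro mult_strict_left_mono) auto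
  hence "t ^ (n - s + 1) + real (s - 1) * t ^ (n - s + 2) < t ^ (n - s + 1) + real m * t ^ (n - s + 1)"
    using m(1) by simp
  also have "\<dots> = real (length cs) * t ^ (n - s + 1)" unfolding cs(1) m(1) by (simp add: algebra_simps)
  also have "\<dots> \<le> (\<Sum>c\<leftarrow>cs. t ^ c)"
    using t cs(3) by (intro sum_list_ge_length_mult power_decreasing) auto
  finally show ?thesis .
qed

lemma sum_power_infty_greater_min:
  fixes t :: real
  assumes t: "0 < t" "t < 1" and ks: "\<And>k. k \<in> set ks \<Longrightarrow> k \<ge> 1" "length ks = s" "s \<ge> 2"
    and sum: "Suc (sum_list ks) = n" and n: "n \<ge> s + 1"
  shows "(\<Sum>c \<in># mset (map (\<lambda>k. k + (n - s - 1) + 2) (0 # replicate (s - 1) 1)). t ^ c) <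
    (\<Sum>c \<in># mset (map Suc ks). t ^ c)"
proof -
  have "c \<le> n - s + 1" if "c \<in> set (map Suc ks)" for c
    using that length_add_le_sum_list[OF ks(1)] ks(2) sum n by fastforce
  hence "t ^ (n - s + 1) + real (s - 1) * t ^ (n - s + 2) < (\<Sum>c\<leftarrow>map Suc ks. t ^ c)"
    using ks by (intro sum_power_short_cycles_greater_min[OF t]) auto
  also have "\<dots> = (\<Sum>c \<in># mset (map Suc ks). t ^ c)"
    by (simp only: sum_mset_sum_list mset_map[symmetric])
  finally show ?thesis unfolding sum_power_theta_min[OF ks(3) n] .
qed

lemma sum_power_theta_greater_min:
  fixes t :: real
  assumes t: "0 < t" "t < 1" and ks: "count_list ks 0 \<le> 1" "length ks = s" "s \<ge> 2"
    and sum: "sum_list ks + l + 2 = n" and n: "n \<ge> s + 1"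
    and ne: "mset ks \<noteq> mset (0 # replicate (s - 1) 1)"
  shows "(\<Sum>c \<in># mset (map (\<lambda>k. k + (n - s - 1) + 2) (0 # replicate (s - 1) 1)). t ^ c) <
    (\<Sum>c \<in># mset (map (\<lambda>k. k + l + 2) ks). t ^ c)"
proof (cases "0 \<in> set ks")
  case False
  hence pos: "k \<ge> 1" if "k \<in> set ks" for k using that by (cases k) auto
  \<comment> \<open>If all \<open>k \<ge> 1\<close>, then
    \<open>s + k \<le> Suc (sum_list ks)\<close>, and the latter is
    \<open>n - l - 1\<close>.\<close>
  have "c \<le> n - s + 1" if "c \<in> set (map (\<lambda>k. k + l + 2) ks)" for c
    using that length_add_le_sum_list[OF pos] ks(2) sum n by fastforce
  hence "t ^ (n - s + 1) + real (s - 1) * t ^ (n - s + 2) < (\<Sum>c\<leftarrow>map (\<lambda>k. k + l + 2) ks. t ^ c)"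
    using ks by (intro sum_power_short_cycles_greater_min[OF t]) auto
  also have "\<dots> = (\<Sum>c \<in># mset (map (\<lambda>k. k + l + 2) ks). t ^ c)"
    by (simp only: sum_mset_sum_list mset_map[symmetric])
  finally show ?thesis unfolding sum_power_theta_min[OF ks(3) n] .
next
  case True
  \<comment> \<open>One path is a single arc, giving a cycle of length \<open>l + 2\<close>;
    \<open>xs\<close> lists the positive parameters of the others, whose cycles have length at most
    \<open>n - s + 2\<close>. The strict gain comes from the cycle of length
    \<open>l + 2\<close>.\<close>
  define xs where "xs = remove1 0 ks"
  have ms: "mset ks = add_mset 0 (mset xs)" using True by (simp add: xs_def)
  have "count (mset ks) 0 \<le> 1" using ks(1) by (simp add: count_mset)
  hence "count (mset xs) 0 = 0" using ms by simp
  hence "0 \<notin> set xs" by (simp only: count_eq_zero_iff set_mset_mset not_False_eq_True)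
  hence pos: "k \<ge> 1" if "k \<in> set xs" for k using that by (cases k) auto
  have len: "length xs = s - 1" using True ks(2) by (simp add: xs_def length_remove1)
  have sumx: "sum_list ks = sum_list xs" using ms by (simp flip: sum_mset_sum_list)
  obtain x where x: "x \<in> set xs" using len ks(3) by (cases xs) auto
  \<comment> \<open>A total of \<open>s - 1\<close> would make every entry of \<open>xs\<close>
    equal to 1, which is the excluded extremal case. So the total is larger, and
    \<open>l + 2 = n - sum_list xs\<close> is less than \<open>n - s + 1\<close>.\<close>
  have "s - 1 \<noteq> sum_list xs"
  proof
    assume eq: "s - 1 = sum_list xs"
    have "k = 1" if "k \<in> set xs" for k
      using length_add_le_sum_list[OF pos that] pos[OF that] eq len by simp
    hence "xs = replicate (s - 1) 1" using len by (simp add: replicate_eqI)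
    thus False using ne ms by simp
  qed
  moreover have "s - 1 \<le> sum_list xs" using length_add_le_sum_list[OF pos x] pos[OF x] len by simp
  ultimately have "l + 2 < n - s + 1" using sum sumx ks(3) by simp
  hence "t ^ (n - s + 1) < t ^ (l + 2)" using t by (intro power_strict_decreasing) auto
  moreover have "real (length xs) * t ^ (n - s + 2) \<le> (\<Sum>k\<leftarrow>xs. t ^ (k + l + 2))"
  proof (rule sum_list_ge_length_mult)
    fix k assume k: "k \<in> set xs"
    have "k + l + 2 \<le> n - s + 2"
      using length_add_le_sum_list[OF pos k] len sum sumx n by simp
    thus "t ^ (n - s + 2) \<le> t ^ (k + l + 2)" using t by (intro power_decreasing) auto
  qed
  moreover have "(\<Sum>c \<in># mset (map (\<lambda>k. k + l + 2) ks). t ^ c) =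
      t ^ (l + 2) + (\<Sum>k\<leftarrow>xs. t ^ (k + l + 2))"
    by (simp add: ms multiset.map_comp comp_def flip: sum_mset_sum_list)
  ultimately show ?thesis unfolding sum_power_theta_min[OF ks(3) n] using len by simp
qed

section \<open>Membership in the family and the extremal digraphs\<close>

lemma theta_infty_family_infty_digraph:
  assumes "\<And>k. k \<in> set ks \<Longrightarrow> k \<ge> 1"
  shows "theta_infty_family (Suc (sum_list ks)) (length ks) (infty_digraph ks)"
proof -
  have G: "digraph (infty_digraph ks)" using assms by (rule digraph_infty_digraph)
  have "is_infty_digraph (infty_digraph ks)"
    unfolding is_infty_digraph_def using infty_digraph_mset_cong[OF refl] assms by blast
  moreover have "card (dicycles (infty_digraph ks)) = length ks"
    using card_dicycles_hub[OF digraph.axioms(1)[OF G] hub_cycle_lengths_infty_digraph] assms by simp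
  ultimately show ?thesis
    using G by (simp add: theta_infty_family_def card_verts_infty_digraph)
qed

lemma theta_infty_family_theta_digraph:
  assumes "count_list ks 0 \<le> 1"
  shows "theta_infty_family (sum_list ks + l + 2) (length ks) (theta_digraph ks l)"
proof -
  have "is_theta_digraph (theta_digraph ks l)"
    unfolding is_theta_digraph_def using theta_digraph_mset_cong[OF refl] assms by blast
  moreover have "card (dicycles (theta_digraph ks l)) = length ks"
    using card_dicycles_hub[OF digraph.axioms(1)[OF digraph_theta_digraph]
        hub_cycle_lengths_theta_digraph[OF assms]] by simp
  ultimately show ?thesis
    using digraph_theta_digraph[of ks l]
    by (simp add: theta_infty_family_def card_verts_theta_digraph)
qed

text \<open>Counting vertices and cycles through the isomorphism turns \<open>n\<close> and
  \<open>s\<close> into conditions on the parameters, and the multiset of cycle lengths is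
  transferred to \<open>G\<close> itself.\<close>

lemma theta_infty_family_cases:
  assumes "theta_infty_family n s G"
  obtains (infty) ks where "\<And>k. k \<in> set ks \<Longrightarrow> k \<ge> 1" "digraph_iso G (infty_digraph ks)"
      "length ks = s" "Suc (sum_list ks) = n" "hub_cycle_lengths G (mset (map Suc ks))"
  | (theta) ks l where "count_list ks 0 \<le> 1" "digraph_iso G (theta_digraph ks l)"
      "length ks = s" "sum_list ks + l + 2 = n"
      "hub_cycle_lengths G (mset (map (\<lambda>k. k + l + 2) ks))"
proof -
  have G: "digraph G" and n: "card (verts G) = n" and s: "card (dicycles G) = s"
    using assms by (simp_all add: theta_infty_family_def)
  have fin: "fin_digraph G" using G by (rule digraph.axioms(1))
  hence wf: "wf_digraph G" by (rule fin_digraph.axioms(1))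
  have "is_theta_digraph G \<or> is_infty_digraph G"
    using assms by (simp add: theta_infty_family_def)
  thus ?thesis
  proof
    assume "is_theta_digraph G"
    then obtain ks l where ks: "count_list ks 0 \<le> 1" and iso: "digraph_iso G (theta_digraph ks l)"
      unfolding is_theta_digraph_def by blast
    have hub: "hub_cycle_lengths G (mset (map (\<lambda>k. k + l + 2) ks))"
      by (rule hub_cycle_lengths_iso[OF wf iso hub_cycle_lengths_theta_digraph[OF ks]])
    show ?thesis
    proof (rule theta[OF ks iso _ _ hub])
      show "length ks = s" using card_dicycles_hub[OF fin hub] s by simp
      show "sum_list ks + l + 2 = n" using card_verts_iso[OF iso] n card_verts_theta_digraph by simp
    qed
  next
    assume "is_infty_digraph G"
    then obtain ks where ks: "\<And>k. k \<in> set ks \<Longrightarrow> k \<ge> 1" and iso: "digraph_iso G (infty_digraph ks)"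
      unfolding is_infty_digraph_def by blast
    have hub: "hub_cycle_lengths G (mset (map Suc ks))"
      by (rule hub_cycle_lengths_iso[OF wf iso hub_cycle_lengths_infty_digraph[OF ks]])
    show ?thesis
    proof (rule infty[OF ks iso _ _ hub])
      show "length ks = s" using card_dicycles_hub[OF fin hub] s by simp
      show "Suc (sum_list ks) = n" using card_verts_iso[OF iso] n card_verts_infty_digraph by simp
    qed
  qed
qed

theorem theorem2p10:
  fixes \<alpha> :: real and n s :: nat
  assumes "0 \<le> \<alpha>" and "\<alpha> < 1" and "s \<ge> 2" and "n \<ge> s + 1"
  defines "Gmax \<equiv> infty_digraph (replicate (s - 1) 1 @ [n - s])"
    and "Gmin \<equiv> theta_digraph (0 # replicate (s - 1) 1) (n - s - 1)"
  shows "theta_infty_family n s Gmax \<and>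
    theta_infty_family n s Gmin \<and>
    (\<forall>G :: ('a, 'b) pre_digraph. theta_infty_family n s G \<longrightarrow>
        A_alpha_radius \<alpha> G \<le> A_alpha_radius \<alpha> Gmax \<and>
        (A_alpha_radius \<alpha> G = A_alpha_radius \<alpha> Gmax \<longleftrightarrow> digraph_iso G Gmax) \<and>
        A_alpha_radius \<alpha> Gmin \<le> A_alpha_radius \<alpha> G \<and>
        (A_alpha_radius \<alpha> G = A_alpha_radius \<alpha> Gmin \<longleftrightarrow> digraph_iso G Gmin))"
proof (intro conjI allI impI)
  note \<alpha> = assms(1,2) and s = assms(3) and n = assms(4)
  let ?kmax = "replicate (s - 1) 1 @ [n - s]" and ?kmin = "0 # replicate (s - 1) (1::nat)"
  have kmax: "k \<ge> 1" if "k \<in> set ?kmax" for k using that n by auto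
  have kmin: "count_list ?kmin 0 \<le> 1" by (simp add: count_list_0_iff)
  have "sum_list (replicate (s - 1) (1::nat)) = s - 1" by (simp add: sum_list_replicate)
  hence sums: "Suc (sum_list ?kmax) = n" "sum_list ?kmin + (n - s - 1) + 2 = n"
    using s n by simp_all
  have lens: "length ?kmax = s" "length ?kmin = s" using s by simp_all
  show "theta_infty_family n s Gmax"
    using theta_infty_family_infty_digraph[of ?kmax, OF kmax] unfolding sums(1) lens(1) Gmax_def .
  show "theta_infty_family n s Gmin"
    using theta_infty_family_theta_digraph[OF kmin, of "n - s - 1"] unfolding sums(2) lens(2) Gmin_def .
  have Gmax: "digraph Gmax" "hub_cycle_lengths Gmax (mset (map Suc ?kmax))"
    unfolding Gmax_def
    using digraph_infty_digraph[of ?kmax] hub_cycle_lengths_infty_digraph[of ?kmax] kmax by blast+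
  have Gmin: "digraph Gmin" "hub_cycle_lengths Gmin (mset (map (\<lambda>k. k + (n - s - 1) + 2) ?kmin))"
    unfolding Gmin_def using digraph_theta_digraph hub_cycle_lengths_theta_digraph[OF kmin] by blast+
  fix G :: "('a, 'b) pre_digraph"
  assume fam: "theta_infty_family n s G"
  have G: "digraph G" using fam by (simp add: theta_infty_family_def)
  have wf: "wf_digraph G" using G digraph.axioms(1) fin_digraph.axioms(1) by blast
  have eq_max: "A_alpha_radius \<alpha> G = A_alpha_radius \<alpha> Gmax" if "digraph_iso G Gmax"
    by (rule A_alpha_radius_hub_eq[OF G hub_cycle_lengths_iso[OF wf that Gmax(2)] Gmax \<alpha>])
      (use s in simp)
  have eq_min: "A_alpha_radius \<alpha> G = A_alpha_radius \<alpha> Gmin" if "digraph_iso G Gmin"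
    by (rule A_alpha_radius_hub_eq[OF G hub_cycle_lengths_iso[OF wf that Gmin(2)] Gmin \<alpha>])
      (use s in simp)
  \<comment> \<open>Together with \<open>eq_max\<close>, this dichotomy gives both the bound and the
    characterization of equality; \<open>min\<close> below does the same for the minimum.\<close>
  have max: "digraph_iso G Gmax \<or> A_alpha_radius \<alpha> G < A_alpha_radius \<alpha> Gmax"
    using fam
  proof (cases rule: theta_infty_family_cases)
    case (infty ks)
    show ?thesis
    proof (cases "mset ks = mset ?kmax")
      case True
      thus ?thesis using digraph_iso_trans[OF infty(2) infty_digraph_mset_cong[OF True infty(1)]]
        unfolding Gmax_def by blast
    next
      case False
      have "A_alpha_radius \<alpha> G < A_alpha_radius \<alpha> Gmax"
        by (rule A_alpha_radius_hub_less[OF G infty(5) Gmax \<alpha> _ _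
              sum_power_infty_less_max[OF _ _ infty(1,3) _ infty(4) False]])
          (use infty(3) s in simp_all)
      thus ?thesis ..
    qed
  next
    case (theta ks l)
    have "A_alpha_radius \<alpha> G < A_alpha_radius \<alpha> Gmax"
      by (rule A_alpha_radius_hub_less[OF G theta(5) Gmax \<alpha> _ _
            sum_power_theta_less_max[OF _ _ theta(3) s theta(4) n]])
        (use theta(3) s in simp_all)
    thus ?thesis ..
  qed
  have min: "digraph_iso G Gmin \<or> A_alpha_radius \<alpha> Gmin < A_alpha_radius \<alpha> G"
    using fam
  proof (cases rule: theta_infty_family_cases)
    case (infty ks)
    have "A_alpha_radius \<alpha> Gmin < A_alpha_radius \<alpha> G"
      by (rule A_alpha_radius_hub_less[OF Gmin G infty(5) \<alpha> _ _
            sum_power_infty_greater_min[OF _ _ infty(1,3) s infty(4) n]])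
        (use infty(3) s in simp_all)
    thus ?thesis ..
  next
    case (theta ks l)
    show ?thesis
    proof (cases "mset ks = mset ?kmin")
      case True
      \<comment> \<open>Since \<open>n\<close> is fixed, equal path parameters force equal return
        paths, so \<open>l\<close> needs no separate comparison.\<close>
      have "sum_list ks = sum_list ?kmin" using arg_cong[OF True, of sum_mset] by (simp only: sum_mset_sum_list)
      hence "l = n - s - 1" using theta(4) sums(2) by linarith
      thus ?thesis using digraph_iso_trans[OF theta(2) theta_digraph_mset_cong[OF True]]
        unfolding Gmin_def by blast
    next
      case False
      have "A_alpha_radius \<alpha> Gmin < A_alpha_radius \<alpha> G"
        by (rule A_alpha_radius_hub_less[OF Gmin G theta(5) \<alpha> _ _
              sum_power_theta_greater_min[OF _ _ theta(1,3) s theta(4) n False]])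
          (use theta(3) s in simp_all)
      thus ?thesis ..
    qed
  qed
  show "A_alpha_radius \<alpha> G \<le> A_alpha_radius \<alpha> Gmax" using max eq_max by fastforce
  show "A_alpha_radius \<alpha> G = A_alpha_radius \<alpha> Gmax \<longleftrightarrow> digraph_iso G Gmax"
    using max eq_max by fastforce
  show "A_alpha_radius \<alpha> Gmin \<le> A_alpha_radius \<alpha> G" using min eq_min by fastforce
  show "A_alpha_radius \<alpha> G = A_alpha_radius \<alpha> Gmin \<longleftrightarrow> digraph_iso G Gmin"
    using min eq_min by fastforce
qed

end
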